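(* Let $n\ge1$ be an integer and $e_n=\frac12\operatorname{lcm}(1,2,\ldots,2n+2)$. Let $R$ be a torsion-free commutative ring, and let $P(T)\in(R\otimes\mathbb Q)[T]$ be an odd polynomial (that is, $P(-T)=-P(T)$) of degree at most $2n+1$ such that $P(m)\in R$ for every $m\in\mathbb Z$. Then $$e_nP'(0)\in R .$$ The factor $e_n$ is optimal: already for $R=\mathbb Z$, if a positive integer $e$ satisfies $eP'(0)\in\mathbb Z$ for every such polynomial $P$, then $e_n\mid e$. More precisely, $$e_nP'(0)=\sum_{q=1}^{n+1}A_{n,q}P(q),$$ where the numbers $$A_{n,q}=(-1)^{q+1}\frac{2e_n}{q}\,\frac{\binom{2n+2}{n+1-q}}{\binom{2n+2}{n+1}},\qquad 1\le q\le n+1,$$ are integers.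
   Context: Torsion-free means torsion-free as an abelian group, so that $R\subset R\otimes\mathbb Q$. *)

theory Defs
  imports
    "HOL-Library.Poly_Mapping"
    "HOL-Computational_Algebra.Polynomial"
begin

section \<open>Tensor products over the integers\<close>

text \<open>
  The tensor product of two abelian groups is the free abelian group on the pairs,
  modulo the subgroup generated by the bilinearity relations.
\<close>

inductive_set tensor_relations ::
  "('a::ab_group_add \<times> 'b::ab_group_add \<Rightarrow>\<^sub>0 int) set" where
  zero: "0 \<in> tensor_relations"
| diff: "x \<in> tensor_relations \<Longrightarrow> y \<in> tensor_relations \<Longrightarrow> x - y \<in> tensor_relations"
| left: "frag_of (a + a', b) - frag_of (a, b) - frag_of (a', b) \<in> tensor_relations"
| right: "frag_of (a, b + b') - frag_of (a, b) - frag_of (a, b') \<in> tensor_relations"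

lemma tensor_relations_uminus: "x \<in> tensor_relations \<Longrightarrow> - x \<in> tensor_relations"
  using tensor_relations.diff[OF tensor_relations.zero] by fastforce

lemma tensor_relations_add:
  "x \<in> tensor_relations \<Longrightarrow> y \<in> tensor_relations \<Longrightarrow> x + y \<in> tensor_relations"
  using tensor_relations.diff[of x "- y"] tensor_relations_uminus by fastforce

definition tensor_rel ::
  "('a::ab_group_add \<times> 'b::ab_group_add \<Rightarrow>\<^sub>0 int) \<Rightarrow> ('a \<times> 'b \<Rightarrow>\<^sub>0 int) \<Rightarrow> bool" where
  "tensor_rel x y \<longleftrightarrow> x - y \<in> tensor_relations"

lemma equivp_tensor_rel:
  "equivp (tensor_rel :: ('a::ab_group_add \<times> 'b::ab_group_add \<Rightarrow>\<^sub>0 int) \<Rightarrow> _)"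
proof (rule equivpI)
  show "reflp (tensor_rel :: ('a \<times> 'b \<Rightarrow>\<^sub>0 int) \<Rightarrow> _)"
    by (simp add: reflp_def tensor_rel_def tensor_relations.zero)
  show "symp (tensor_rel :: ('a \<times> 'b \<Rightarrow>\<^sub>0 int) \<Rightarrow> _)"
    unfolding symp_def tensor_rel_def by (metis tensor_relations_uminus minus_diff_eq)
  show "transp (tensor_rel :: ('a \<times> 'b \<Rightarrow>\<^sub>0 int) \<Rightarrow> _)"
  proof (rule transpI)
    fix x y z :: "'a \<times> 'b \<Rightarrow>\<^sub>0 int"
    assume "tensor_rel x y" "tensor_rel y z"
    then have "(x - y) + (y - z) \<in> tensor_relations"
      unfolding tensor_rel_def by (rule tensor_relations_add)
    then show "tensor_rel x z"
      by (simp add: tensor_rel_def)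
  qed
qed

quotient_type (overloaded) ('a, 'b) tensor =
  "('a::ab_group_add \<times> 'b::ab_group_add) \<Rightarrow>\<^sub>0 int" / tensor_rel
  by (rule equivp_tensor_rel)

lift_definition pure_tensor :: "'a::ab_group_add \<Rightarrow> 'b::ab_group_add \<Rightarrow> ('a, 'b) tensor"
  is "\<lambda>a b. frag_of (a, b)" .

instantiation tensor :: (ab_group_add, ab_group_add) ab_group_add
begin

lift_definition zero_tensor :: "('a, 'b) tensor" is 0 .

lift_definition plus_tensor :: "('a, 'b) tensor \<Rightarrow> ('a, 'b) tensor \<Rightarrow> ('a, 'b) tensor"
  is "(+)"
  unfolding tensor_rel_def by (metis add_diff_add tensor_relations_add)

lift_definition uminus_tensor :: "('a, 'b) tensor \<Rightarrow> ('a, 'b) tensor" is uminus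
  unfolding tensor_rel_def by (metis minus_diff_minus tensor_relations_uminus)

lift_definition minus_tensor :: "('a, 'b) tensor \<Rightarrow> ('a, 'b) tensor \<Rightarrow> ('a, 'b) tensor"
  is "(-)"
proof -
  fix x x' y y' :: "'a \<times> 'b \<Rightarrow>\<^sub>0 int"
  assume "tensor_rel x x'" "tensor_rel y y'"
  then have "(x - x') - (y - y') \<in> tensor_relations"
    unfolding tensor_rel_def by (rule tensor_relations.diff)
  then show "tensor_rel (x - y) (x' - y')"
    by (simp add: tensor_rel_def algebra_simps)
qed

instance
  by standard (transfer; simp add: tensor_rel_def tensor_relations.zero algebra_simps)+

end

text \<open>
  Multiplication is the biadditive extension of
  \<open>(a \<otimes> b) * (c \<otimes> d) = (a * c) \<otimes> (b * d)\<close>.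
\<close>

definition frag_times ::
  "('a::comm_ring \<times> 'b::comm_ring \<Rightarrow>\<^sub>0 int) \<Rightarrow> ('a \<times> 'b \<Rightarrow>\<^sub>0 int) \<Rightarrow> ('a \<times> 'b \<Rightarrow>\<^sub>0 int)"
  where
  "frag_times x y =
     frag_extend (\<lambda>p. frag_extend (\<lambda>q. frag_of (fst p * fst q, snd p * snd q)) y) x"

lemma frag_times_frag_of: "frag_times (frag_of (a, b)) (frag_of (c, d)) = frag_of (a * c, b * d)"
  by (simp add: frag_times_def)

lemma frag_times_0: "frag_times 0 y = 0" "frag_times x 0 = 0"
  by (simp_all add: frag_times_def frag_extend_eq_0)

lemma frag_times_diff_left: "frag_times (x - x') y = frag_times x y - frag_times x' y"
  by (simp add: frag_times_def frag_extend_diff)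

lemma frag_induct [case_names zero one diff]:
  assumes "P 0" "\<And>a b. P (frag_of (a, b))" "\<And>x y. P x \<Longrightarrow> P y \<Longrightarrow> P (x - y)"
  shows "P (x :: 'a \<times> 'b \<Rightarrow>\<^sub>0 int)"
  by (rule frag_induction[of x UNIV]) (use assms in auto)

lemma frag_times_diff_right: "frag_times x (y - y') = frag_times x y - frag_times x y'"
  by (induction x rule: frag_induct)
    (simp_all add: frag_times_0 frag_times_diff_left, simp add: frag_times_def frag_extend_diff)

lemma frag_times_commute: "frag_times x y = frag_times y x"
proof (induction x rule: frag_induct)
  case (one a b)
  show ?case
    by (induction y rule: frag_induct)
      (simp_all add: frag_times_0 frag_times_diff_left frag_times_diff_right
        frag_times_frag_of mult.commute)
qed (simp_all add: frag_times_0 frag_times_diff_left frag_times_diff_right)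

lemma frag_times_assoc: "frag_times (frag_times x y) z = frag_times x (frag_times y z)"
proof (induction x rule: frag_induct)
  case (one a b)
  show ?case
  proof (induction y rule: frag_induct)
    case (one c d)
    show ?case
      by (induction z rule: frag_induct)
        (simp_all add: frag_times_0 frag_times_diff_left frag_times_diff_right
          frag_times_frag_of mult.assoc)
  qed (simp_all add: frag_times_0 frag_times_diff_left frag_times_diff_right)
qed (simp_all add: frag_times_0 frag_times_diff_left frag_times_diff_right)

lemma frag_times_tensor_relations:
  assumes "x \<in> tensor_relations"
  shows "frag_times x y \<in> tensor_relations"
proof (induction y rule: frag_induct)
  case zero
  show ?case by (simp add: frag_times_0 tensor_relations.zero)
next
  case (diff y y')
  then show ?case by (simp add: frag_times_diff_right tensor_relations.diff)
next
  case (one c d)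
  show ?case
    using assms
    by (induction rule: tensor_relations.induct)
      (simp_all add: frag_times_0 frag_times_diff_left frag_times_frag_of distrib_right
        tensor_relations.intros)
qed

instantiation tensor :: (comm_ring, comm_ring) comm_ring
begin

lift_definition times_tensor :: "('a, 'b) tensor \<Rightarrow> ('a, 'b) tensor \<Rightarrow> ('a, 'b) tensor"
  is frag_times
proof -
  fix x x' y y' :: "'a \<times> 'b \<Rightarrow>\<^sub>0 int"
  assume "tensor_rel x x'" "tensor_rel y y'"
  then have "frag_times (x - x') y + frag_times (y - y') x' \<in> tensor_relations"
    unfolding tensor_rel_def by (intro tensor_relations_add frag_times_tensor_relations)
  also have "frag_times (x - x') y + frag_times (y - y') x' = frag_times x y - frag_times x' y'"
    by (simp add: frag_times_diff_left frag_times_commute[of x'])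
  finally show "tensor_rel (frag_times x y) (frag_times x' y')"
    by (simp add: tensor_rel_def)
qed

instance
proof
  fix a b c :: "('a, 'b) tensor"
  show "a * b * c = a * (b * c)"
    by transfer (simp add: frag_times_assoc tensor_rel_def tensor_relations.zero)
  show "a * b = b * a"
    by transfer (simp add: frag_times_commute tensor_rel_def tensor_relations.zero)
  have "frag_times (x + y) z = frag_times x z + frag_times y z"
    for x y z :: "'a \<times> 'b \<Rightarrow>\<^sub>0 int"
    by (simp add: frag_times_def frag_extend_add)
  then show "(a + b) * c = a * c + b * c"
    by transfer (simp add: tensor_rel_def tensor_relations.zero)
qed

end

text \<open>
  The sort \<open>{comm_ring, comm_monoid_mult}\<close> is that of commutative rings with one,
  including the zero ring, which \<open>comm_ring_1\<close> excludes.
\<close>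

instantiation tensor ::
  ("{comm_ring, comm_monoid_mult}", "{comm_ring, comm_monoid_mult}") comm_monoid_mult
begin

lift_definition one_tensor :: "('a, 'b) tensor" is "frag_of (1, 1)" .

instance
proof
  fix a :: "('a, 'b) tensor"
  have "frag_times (frag_of (1, 1)) x = x" for x :: "'a \<times> 'b \<Rightarrow>\<^sub>0 int"
    by (induction x rule: frag_induct)
      (simp_all add: frag_times_0 frag_times_diff_right frag_times_frag_of)
  then show "1 * a = a"
    by transfer (simp add: tensor_rel_def tensor_relations.zero)
qed

end

lemma pure_tensor_add_left: "pure_tensor (a + a') b = pure_tensor a b + pure_tensor a' b"
  by transfer (use tensor_relations.left in \<open>simp add: tensor_rel_def diff_diff_eq\<close>)

lemma pure_tensor_add_right: "pure_tensor a (b + b') = pure_tensor a b + pure_tensor a b'"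
  by transfer (use tensor_relations.right in \<open>simp add: tensor_rel_def diff_diff_eq\<close>)

lemma pure_tensor_mult: "pure_tensor a b * pure_tensor c d = pure_tensor (a * c) (b * d)"
  by transfer (simp add: tensor_rel_def frag_times_frag_of tensor_relations.zero)

lemma one_tensor_eq: "1 = pure_tensor 1 1"
  by transfer (simp add: tensor_rel_def tensor_relations.zero)


section \<open>Torsion-free rings and their rationalization\<close>

definition torsion_free :: "'a::ab_group_add itself \<Rightarrow> bool" where
  "torsion_free _ \<longleftrightarrow> (\<forall>(k::nat) (x::'a). k > 0 \<longrightarrow> (\<Sum>i<k. x) = 0 \<longrightarrow> x = 0)"

lemma torsion_free_int: "torsion_free TYPE(int)"
  by (simp add: torsion_free_def)

text \<open>The ring \<open>R\<close> as a subring of \<open>R \<otimes> \<rat>\<close>, and the structure map \<open>\<rat> \<rightarrow> R \<otimes> \<rat>\<close>.\<close>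

definition base_elem :: "'a::ab_group_add \<Rightarrow> ('a, rat) tensor" where
  "base_elem a = pure_tensor a 1"

definition base_ring :: "('a::ab_group_add, rat) tensor set" where
  "base_ring = range base_elem"

definition rat_elem :: "rat \<Rightarrow> ('a::{comm_ring, comm_monoid_mult}, rat) tensor" where
  "rat_elem q = pure_tensor 1 q"

definition int_mult :: "int \<Rightarrow> 'a::ab_group_add \<Rightarrow> 'a" where
  "int_mult k x = (\<Sum>i<nat k. x) - (\<Sum>i<nat (- k). x)"

lemma nat_sum_add: "(\<Sum>i<m + n. x) = (\<Sum>i<m. x) + (\<Sum>i<n. x)"
  for m n :: nat and x :: "'a::comm_monoid_add"
  by (induction n) (simp_all add: add_ac)

lemma int_mult_diff_nat: "int_mult (int m - int n) x = (\<Sum>i<m. x) - (\<Sum>i<n. x)"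
proof (cases "n \<le> m")
  case True
  then have "(\<Sum>i<m. x) = (\<Sum>i<m - n. x) + (\<Sum>i<n. x)"
    using nat_sum_add[of x "m - n" n] by simp
  then show ?thesis using True by (simp add: int_mult_def flip: of_nat_diff)
next
  case False
  then have "(\<Sum>i<n. x) = (\<Sum>i<n - m. x) + (\<Sum>i<m. x)"
    using nat_sum_add[of x "n - m" m] by simp
  moreover have "nat (int m - int n) = 0" "nat (- (int m - int n)) = n - m"
    using False by auto
  ultimately show ?thesis by (simp add: int_mult_def)
qed

lemma int_mult_add_left: "int_mult (k + l) x = int_mult k x + int_mult l x"
proof -
  obtain a b where k: "k = int a - int b" by (meson int_diff_cases)
  obtain c d where l: "l = int c - int d" by (meson int_diff_cases)
  have "k + l = int (a + c) - int (b + d)" by (simp add: k l)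
  then have "int_mult (k + l) x = (\<Sum>i<a + c. x) - (\<Sum>i<b + d. x)"
    by (simp only: int_mult_diff_nat)
  then show ?thesis
    by (simp add: int_mult_diff_nat nat_sum_add k l)
qed

lemma int_mult_add_right: "int_mult k (x + y) = int_mult k x + int_mult k y"
  by (simp add: int_mult_def sum.distrib)

text \<open>
  Torsion-freeness makes the map from \<open>R\<close> to \<open>R \<otimes> \<rat>\<close> injective, which justifies
  regarding \<^const>\<open>base_ring\<close> as \<open>R\<close>.
\<close>

lemma base_elem_eq_0:
  fixes a :: "'a::ab_group_add"
  assumes tf: "torsion_free TYPE('a)" and "base_elem a = 0"
  shows "a = 0"
proof -
  define \<phi> :: "int \<Rightarrow> ('a \<times> rat \<Rightarrow>\<^sub>0 int) \<Rightarrow> 'a" where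
    "\<phi> N x = (\<Sum>p\<in>Poly_Mapping.keys x.
       int_mult (Poly_Mapping.lookup x p) (int_mult \<lfloor>of_int N * snd p\<rfloor> (fst p)))" for N x
  have int_mult_0: "int_mult 0 y = 0" for y :: 'a
    by (simp add: int_mult_def)
  have int_mult_diff: "int_mult (k - l) y = int_mult k y - int_mult l y" for k l and y :: 'a
    using int_mult_add_left[of "k - l" l y] by simp
  have \<phi>_superset: "\<phi> N x = (\<Sum>p\<in>S.
      int_mult (Poly_Mapping.lookup x p) (int_mult \<lfloor>of_int N * snd p\<rfloor> (fst p)))"
    if "finite S" "Poly_Mapping.keys x \<subseteq> S" for N x S
    unfolding \<phi>_def by (rule sum.mono_neutral_left) (use that in \<open>auto simp: in_keys_iff int_mult_0\<close>)
  have \<phi>_diff: "\<phi> N (x - y) = \<phi> N x - \<phi> N y" for N x y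
  proof -
    let ?S = "Poly_Mapping.keys x \<union> Poly_Mapping.keys y"
    have "Poly_Mapping.keys (x - y) \<subseteq> ?S" by (rule keys_diff)
    then show ?thesis
      by (simp add: \<phi>_superset[of ?S] lookup_minus int_mult_diff sum_subtractf)
  qed
  have \<phi>_of: "\<phi> N (frag_of (b, q)) = int_mult \<lfloor>of_int N * q\<rfloor> b" for N b q
    by (simp add: \<phi>_def int_mult_def)
  have vanish: "\<exists>N>0. \<forall>M. N dvd M \<longrightarrow> \<phi> M x = 0" if "x \<in> tensor_relations" for x
    using that
  proof (induction rule: tensor_relations.induct)
    case zero
    show ?case by (auto simp: \<phi>_def intro: exI[of _ 1])
  next
    case (diff x y)
    then obtain N N' where "N > 0" "\<forall>M. N dvd M \<longrightarrow> \<phi> M x = 0"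
      "N' > 0" "\<forall>M. N' dvd M \<longrightarrow> \<phi> M y = 0"
      by (elim exE conjE)
    then show ?case
      by (intro exI[of _ "N * N'"]) (simp add: \<phi>_diff, metis dvd_mult_left dvd_mult_right)
  next
    case (left b b' q)
    show ?case
      by (intro exI[of _ 1]) (simp add: \<phi>_diff \<phi>_of int_mult_add_right)
  next
    case (right b q q')
    obtain c d c' d' where q: "q = of_int c / of_int d" "d > 0" "q' = of_int c' / of_int d'" "d' > 0"
      using Rat_cases[of q] Rat_cases[of q'] unfolding Fract_of_int_quotient by metis
    show ?case
    proof (intro exI[of _ "d * d'"] conjI allI impI)
      show "d * d' > 0" using q by simp
      fix M assume "d * d' dvd M"
      then obtain k where M: "M = d * d' * k" by (rule dvdE)
      have 1: "of_int M * q = of_int (c * d' * k)" using q by (simp add: M)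
      have 2: "of_int M * q' = of_int (c' * d * k)" using q by (simp add: M)
      have 3: "of_int M * (q + q') = of_int (c * d' * k + c' * d * k)"
        unfolding distrib_left 1 2 by simp
      show "\<phi> M (frag_of (b, q + q') - frag_of (b, q) - frag_of (b, q')) = 0"
        unfolding \<phi>_diff \<phi>_of 1 2 3 floor_of_int by (simp add: int_mult_add_left)
    qed
  qed
  have "frag_of (a, 1 :: rat) \<in> tensor_relations"
    using assms(2)
    by (simp add: base_elem_def pure_tensor.abs_eq zero_tensor.abs_eq tensor.abs_eq_iff
        tensor_rel_def)
  from vanish[OF this] obtain N where N: "N > 0" "\<phi> N (frag_of (a, 1)) = 0"
    by (meson dvd_refl)
  then have "(\<Sum>i<nat N. a) = 0"
    by (simp add: \<phi>_of int_mult_def)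
  then show ?thesis
    using tf N(1) unfolding torsion_free_def by (metis zero_less_nat_eq)
qed

lemma inj_base_elem:
  assumes "torsion_free TYPE('a::ab_group_add)"
  shows "inj (base_elem :: 'a \<Rightarrow> _)"
proof (rule injI)
  fix a b :: 'a
  assume "base_elem a = base_elem b"
  moreover have "base_elem a = base_elem (a - b) + base_elem b"
    using pure_tensor_add_left[of "a - b" b] by (simp add: base_elem_def)
  ultimately have "base_elem (a - b) = 0" by simp
  then show "a = b" using base_elem_eq_0[OF assms, of "a - b"] by simp
qed


section \<open>Odd polynomials and their derivative\<close>

definition odd_poly :: "'a::{comm_ring, comm_monoid_mult} poly \<Rightarrow> bool" where
  "odd_poly P \<longleftrightarrow> pcompose P [:0, - 1:] = - P"

text \<open>
  The library's \<^const>\<open>pderiv\<close> is restricted to coefficient rings without zero divisors.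
  The inner sum is \<open>(i + 1)\<close> times the coefficient of degree \<open>i + 1\<close>.
\<close>

definition poly_derivative :: "'a::comm_monoid_add poly \<Rightarrow> 'a poly" where
  "poly_derivative P = (\<Sum>i<degree P. monom (\<Sum>j\<le>i. coeff P (Suc i)) i)"

lemma coeff_poly_derivative: "coeff (poly_derivative P) i = (\<Sum>j\<le>i. coeff P (Suc i))"
proof (cases "i < degree P")
  case True
  then show ?thesis
    by (simp add: poly_derivative_def coeff_sum)
next
  case False
  then have "coeff P (Suc i) = 0" by (simp add: coeff_eq_0)
  with False show ?thesis
    by (simp add: poly_derivative_def coeff_sum)
qed

lemma poly_derivative_eq_pderiv:
  "poly_derivative P = pderiv (P :: 'a::{comm_semiring_1, semiring_no_zero_divisors} poly)"
  by (rule poly_eqI) (simp add: coeff_poly_derivative coeff_pderiv)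


section \<open>The constants and the polynomials of interest\<close>

definition e_const :: "nat \<Rightarrow> nat" where
  "e_const n = Lcm {1..2 * n + 2} div 2"

lemma two_e_const: "2 * e_const n = Lcm {1..2 * n + 2}"
  unfolding e_const_def by (intro dvd_mult_div_cancel dvd_Lcm) simp

definition A_const :: "nat \<Rightarrow> nat \<Rightarrow> rat" where
  "A_const n q = (- 1) ^ (q + 1) * (2 * of_nat (e_const n) / of_nat q) *
     (of_nat ((2 * n + 2) choose (n + 1 - q)) / of_nat ((2 * n + 2) choose (n + 1)))"

definition admissible :: "nat \<Rightarrow> ('a::{comm_ring, comm_monoid_mult}, rat) tensor poly \<Rightarrow> bool" where
  "admissible n P \<longleftrightarrow>
     odd_poly P \<and> degree P \<le> 2 * n + 1 \<and> (\<forall>m::int. poly P (rat_elem (of_int m)) \<in> base_ring)"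

end

theory Submission
  imports Defs
begin

text \<open>
  The formula for \<open>P'(0)\<close> is linear in \<open>P\<close>, so it can be checked on odd monomials, where it
  says that the \<open>2n+2\<close>-nd central difference kills even powers below \<open>2n+2\<close>. With \<open>N = n + 1\<close>,
  \<open>A\<^sub>n\<^sub>,\<^sub>q = \<plusminus> (lcm(1,\<dots>,2N) / (q * binom(N+q, q))) * binom(N, q)\<close>, which is an integer because
  \<open>k * binom(m, k)\<close> divides \<open>lcm(1,\<dots>,m)\<close>. Optimality is witnessed by the polynomials
  \<open>P(x) = binom(x, t) - binom(-x, t)\<close> for \<open>1 \<le> t \<le> 2n + 2\<close>, with \<open>P'(0) = \<plusminus> 2 / t\<close>; for
  \<open>t = 2n + 2\<close> the leading terms cancel.
\<close>

section \<open>Binomial coefficients\<close>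

text \<open>Recurrence of the Leibniz harmonic triangle.\<close>

lemma inverse_binomial_rec:
  assumes "1 \<le> k" "k \<le> m"
  shows "1 / (of_nat (Suc k) * of_nat (Suc m choose Suc k) :: 'a::field_char_0) =
    1 / (of_nat k * of_nat (m choose k)) - 1 / (of_nat k * of_nat (Suc m choose k))"
proof -
  \<comment> \<open>With \<open>m = k + d\<close>, facts 1 and 2 express the other two binomials
    through \<open>m choose k\<close>, leaving a rational identity in \<open>k\<close> and
    \<open>d\<close>.\<close>
  define d where "d = m - k"
  have m: "m = k + d" using assms by (simp add: d_def)
  have k: "of_nat k \<noteq> (0 :: 'a)" using assms by simp
  have s: "1 + (of_nat k + of_nat d) \<noteq> (0 :: 'a)" "1 + of_nat d \<noteq> (0 :: 'a)" "1 + of_nat k \<noteq> (0 :: 'a)"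
    by (simp_all flip: of_nat_add of_nat_Suc)
  have 1: "of_nat (Suc k) * of_nat (Suc m choose Suc k) = (1 + (of_nat k + of_nat d)) * (of_nat (m choose k) :: 'a)"
    using arg_cong[OF Suc_times_binomial[of k m], of "of_nat :: nat \<Rightarrow> 'a"] m
    by (simp add: algebra_simps del: binomial_Suc_Suc)
  have "(Suc m - k) * (Suc m choose k) = Suc m * (m choose k)"
    using binomial_absorb_comp[of "Suc m" k] by simp
  from arg_cong[OF this, of "of_nat :: nat \<Rightarrow> 'a"]
  have 2: "of_nat (Suc m choose k) =
      (1 + (of_nat k + of_nat d)) * (of_nat (m choose k) :: 'a) / (1 + of_nat d)"
    using s m by (simp add: field_simps Suc_diff_le)
  have c: "of_nat (m choose k) \<noteq> (0 :: 'a)" using assms by simp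
  show ?thesis
    unfolding 1 2 using k s c by (simp add: divide_simps)
qed

text \<open>Induction along the harmonic triangle: the entry for \<open>Suc k\<close> in row
  \<open>m\<close> is a difference of entries for \<open>k\<close> in rows \<open>m - 1\<close> and
  \<open>m\<close>, and the entries for \<open>k = 1\<close> are \<open>1 / m\<close>.\<close>

lemma common_multiple_div_binomial_Ints:
  assumes "\<And>d. 1 \<le> d \<Longrightarrow> d \<le> m \<Longrightarrow> d dvd L" "1 \<le> k" "k \<le> m"
  shows "of_nat L / (of_nat k * of_nat (m choose k)) \<in> (\<int> :: 'a::field_char_0 set)"
  using assms(2,1,3)
proof (induction k arbitrary: m rule: nat_induct_at_least)
  case base
  then have "m dvd L" by simp
  then show ?case
    by (auto elim!: dvdE)
next
  case (Suc k)
  then obtain m' where m: "m = Suc m'" "k \<le> m'" by (cases m) auto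
  have "of_nat L / (of_nat (Suc k) * of_nat (m choose Suc k) :: 'a) =
      of_nat L * (1 / (of_nat (Suc k) * of_nat (m choose Suc k)))" by simp
  also have "\<dots> = of_nat L / (of_nat k * of_nat (m' choose k)) -
      of_nat L / (of_nat k * of_nat (m choose k))"
    unfolding m(1) inverse_binomial_rec[OF Suc.hyps m(2)] by (simp add: right_diff_distrib)
  also have "\<dots> \<in> \<int>"
    using m Suc.prems by (intro Ints_diff Suc.IH) auto
  finally show ?case .
qed

text \<open>The \<open>M\<close>-th finite difference kills polynomials of degree below
  \<open>M\<close>. One factor \<open>of_nat k - c\<close> is split off; absorbing its
  \<open>k\<close> into the binomial lowers \<open>M\<close> and \<open>c\<close> by one, so both
  vary in the induction.\<close>

lemma alternating_binomial_power_sum: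
  fixes c :: "'a::comm_ring_1"
  assumes "m < M"
  shows "(\<Sum>k\<le>M. (- 1) ^ k * of_nat (M choose k) * (of_nat k - c) ^ m) = 0"
  using assms
proof (induction m arbitrary: M c)
  case 0
  then show ?case using choose_alternating_sum[of M, where 'a = 'a] by simp
next
  case (Suc m)
  then obtain M' where M: "M = Suc M'" by (cases M) auto
  have "(\<Sum>k\<le>M. (- 1) ^ k * of_nat (M choose k) * (of_nat k - c) ^ Suc m) =
     (\<Sum>k\<le>M. (- 1) ^ k * of_nat (k * (M choose k)) * (of_nat k - c) ^ m)
     - c * (\<Sum>k\<le>M. (- 1) ^ k * of_nat (M choose k) * (of_nat k - c) ^ m)"
    by (simp add: sum_distrib_left algebra_simps flip: sum_subtractf)
  also have "(\<Sum>k\<le>M. (- 1) ^ k * of_nat (M choose k) * (of_nat k - c) ^ m) = 0"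
    using Suc by simp
  \<comment> \<open>The factor \<open>k\<close> kills the term at 0, so the index can be
    shifted.\<close>
  also have "(\<Sum>k\<le>M. (- 1) ^ k * of_nat (k * (M choose k)) * (of_nat k - c) ^ m) =
     (\<Sum>k\<le>M'. (- 1) ^ Suc k * of_nat (Suc k * (M choose Suc k)) * (of_nat (Suc k) - c) ^ m)"
    unfolding M sum.atMost_Suc_shift by simp
  also have "\<dots> = (\<Sum>k\<le>M'. - of_nat M * ((- 1) ^ k * of_nat (M' choose k) * (of_nat k - (c - 1)) ^ m))"
    unfolding M Suc_times_binomial by (simp add: algebra_simps)
  also have "\<dots> = - of_nat M * (\<Sum>k\<le>M'. (- 1) ^ k * of_nat (M' choose k) * (of_nat k - (c - 1)) ^ m)"
    by (simp only: sum_distrib_left)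
  also have "\<dots> = 0" using Suc M by simp
  finally show ?case by simp
qed

lemma sum_atMost_double:
  "(\<Sum>k\<le>2 * N. g k) = g N + (\<Sum>q = 1..N. g (N - q) + g (N + q))"
  for g :: "nat \<Rightarrow> 'a::comm_monoid_add"
proof -
  have "(\<Sum>q = 1..N. g (N - q)) = sum g {..<N}"
    by (rule sum.reindex_bij_witness[of _ "\<lambda>k. N - k" "\<lambda>q. N - q"]) auto
  moreover have "(\<Sum>q = 1..N. g (N + q)) = sum g {N<..2 * N}"
    by (rule sum.reindex_bij_witness[of _ "\<lambda>k. k - N" "\<lambda>q. N + q"]) auto
  moreover have "{..2 * N} = insert N ({..<N} \<union> {N<..2 * N})" by auto
  then have "sum g {..2 * N} = g N + (sum g {..<N} + sum g {N<..2 * N})"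
    by (simp add: sum.union_disjoint[of "{..<N}"] Int_def)
  ultimately show ?thesis by (simp add: sum.distrib)
qed

text \<open>The alternating sum of order \<open>2 * N\<close> with center \<open>N\<close> is folded
  about its middle: the terms at \<open>N - q\<close> and \<open>N + q\<close> agree because the
  exponent is even. The middle term contains \<open>0 ^ (2 * j)\<close>, which is 1 exactly for
  \<open>j = 0\<close>.\<close>

lemma central_binomial_power_sum:
  assumes "j < N"
  shows "2 * (\<Sum>q = 1..N. (- 1) ^ (q + 1) * of_nat (2 * N choose (N - q)) * of_nat q ^ (2 * j)) =
    (if j = 0 then of_nat (2 * N choose N) else 0 :: 'a::comm_ring_1)"
proof -
  define g :: "nat \<Rightarrow> 'a" where
    "g k = (- 1) ^ k * of_nat (2 * N choose k) * (of_nat k - of_nat N) ^ (2 * j)" for k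
  define h :: "nat \<Rightarrow> 'a" where
    "h q = (- 1) ^ (q + 1) * of_nat (2 * N choose (N - q)) * of_nat q ^ (2 * j)" for q
  have g: "g (N - q) + g (N + q) = - ((- 1) ^ N * (2 * h q))" if "q \<in> {1..N}" for q
  proof -
    have 1: "(- 1) ^ (N - q) = ((- 1) ^ (N + q) :: 'a)"
      using that by (auto simp: minus_one_power_iff)
    have 2: "(2 * N choose (N + q)) = (2 * N choose (N - q))"
      using that binomial_symmetric[of "N + q" "2 * N"] by simp
    have 3: "(of_nat (N - q) - of_nat N :: 'a) ^ (2 * j) = of_nat q ^ (2 * j)"
      using that by (simp add: of_nat_diff)
    show ?thesis
      unfolding g_def h_def 1 2 3 by (simp add: power_add algebra_simps)
  qed
  have "0 = (\<Sum>k\<le>2 * N. g k)"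
    unfolding g_def using assms by (intro alternating_binomial_power_sum[symmetric]) simp
  also have "\<dots> = g N + (\<Sum>q = 1..N. - ((- 1) ^ N * (2 * h q)))"
    unfolding sum_atMost_double by (simp only: g cong: sum.cong)
  also have "\<dots> = g N - (- 1) ^ N * (2 * sum h {1..N})"
    by (simp add: sum_negf sum_distrib_left)
  finally have "(- 1) ^ N * (2 * sum h {1..N}) = g N" by simp
  then have "(- 1) ^ N * ((- 1) ^ N * (2 * sum h {1..N})) = (- 1) ^ N * g N" by simp
  then have "2 * sum h {1..N} = (- 1) ^ N * g N"
    by (simp add: mult.assoc[symmetric] flip: power_add mult_2)
  also have "\<dots> = (if j = 0 then of_nat (2 * N choose N) else 0)"
    by (simp add: g_def zero_power mult.assoc[symmetric] flip: power_add mult_2)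
  finally show ?thesis by (simp add: h_def)
qed


section \<open>The numbers \<open>A\<^sub>n\<^sub>,\<^sub>q\<close>\<close>

lemma A_const_Ints:
  assumes "1 \<le> q" "q \<le> n + 1"
  shows "A_const n q \<in> \<int>"
proof -
  define N where "N = n + 1"
  have q: "1 \<le> q" "q \<le> N" using assms by (auto simp: N_def)
  define L where "L = 2 * e_const n"
  have L: "d dvd L" if "1 \<le> d" "d \<le> N + q" for d
    unfolding L_def two_e_const using that q by (intro dvd_Lcm) (auto simp: N_def)
  \<comment> \<open>Both sides count the splittings of \<open>2 * N\<close> points into blocks of
    sizes \<open>N - q\<close>, \<open>q\<close> and \<open>N\<close>.\<close>
  have "(2 * N choose (N - q)) * (N + q choose q) = (2 * N choose N) * (N choose q)"
    using choose_mult_lemma[of q "N - q" N] binomial_symmetric[of "N - q" "2 * N"]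
      binomial_symmetric[of q "N + q"] q
    by (simp add: mult_2 add.commute)
  from arg_cong[OF this, of "of_nat :: nat \<Rightarrow> rat"]
  have "(of_nat (2 * N choose (N - q)) / of_nat (2 * N choose N) :: rat) =
      of_nat (N choose q) / of_nat (N + q choose q)"
    using q by (simp add: field_simps)
  then have "A_const n q = (- 1) ^ (q + 1) * of_nat (N choose q) *
      (of_nat L / (of_nat q * of_nat (N + q choose q)))"
    by (simp add: A_const_def L_def N_def algebra_simps)
  also have "\<dots> \<in> \<int>"
    using L q by (intro Ints_mult[OF _ common_multiple_div_binomial_Ints]) auto
  finally show ?thesis .
qed

text \<open>The derivative formula for the monomial of degree \<open>i\<close>: the
  \<open>1 / q\<close> in \<open>A_const\<close> leaves the even exponent
  \<open>2 * j = i - 1\<close>, to which the central sum applies.\<close>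

lemma sum_A_const_power:
  assumes "odd i" "i \<le> 2 * n + 1"
  shows "(\<Sum>q = 1..n + 1. A_const n q * of_nat q ^ i) = (if i = 1 then of_nat (e_const n) else 0)"
proof -
  from assms obtain j where i: "i = 2 * j + 1" "j < n + 1" by (auto elim!: oddE)
  define C where "C = (of_nat ((2 * n + 2) choose (n + 1)) :: rat)"
  have C: "C \<noteq> 0" by (simp add: C_def del: binomial_Suc_Suc)
  have "(\<Sum>q = 1..n + 1. A_const n q * of_nat q ^ i) = (\<Sum>q = 1..n + 1. of_nat (e_const n) / C *
     (2 * ((- 1) ^ (q + 1) * of_nat (2 * (n + 1) choose (n + 1 - q)) * of_nat q ^ (2 * j))))"
    by (intro sum.cong) (simp_all add: A_const_def i C_def)
  also have "\<dots> = of_nat (e_const n) / C * (2 * (\<Sum>q = 1..n + 1.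
      (- 1) ^ (q + 1) * of_nat (2 * (n + 1) choose (n + 1 - q)) * of_nat q ^ (2 * j)))"
    by (simp only: sum_distrib_left)
  also have "\<dots> = of_nat (e_const n) / C * (if j = 0 then C else 0)"
    by (subst central_binomial_power_sum[OF i(2)]) (simp add: C_def)
  finally show ?thesis using C by (simp add: i)
qed


section \<open>The structure maps of \<open>R \<otimes> \<rat>\<close>\<close>

lemma rat_elem_add: "rat_elem (a + b) = rat_elem a + rat_elem b"
  by (simp add: rat_elem_def pure_tensor_add_right)

lemma rat_elem_mult: "rat_elem (a * b) = rat_elem a * rat_elem b"
  by (simp add: rat_elem_def pure_tensor_mult)

lemma rat_elem_0 [simp]: "rat_elem 0 = 0"
  using rat_elem_add[of 0 0] by simp

lemma rat_elem_1 [simp]: "rat_elem 1 = 1"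
  by (simp add: rat_elem_def one_tensor_eq)

lemma rat_elem_minus: "rat_elem (- a) = - rat_elem a"
  using rat_elem_add[of a "- a"] by (simp add: eq_neg_iff_add_eq_0 add.commute)

lemma rat_elem_sum: "rat_elem (sum f A) = (\<Sum>x\<in>A. rat_elem (f x))"
  by (induction A rule: infinite_finite_induct) (simp_all add: rat_elem_add)

lemma base_elem_0 [simp]: "base_elem 0 = 0"
  using pure_tensor_add_left[of 0 0 1] by (simp add: base_elem_def)

lemma base_elem_add: "base_elem (a + b) = base_elem a + base_elem b"
  by (simp add: base_elem_def pure_tensor_add_left)

lemma base_elem_minus: "base_elem (- a) = - base_elem a"
  using base_elem_add[of a "- a"] by (simp add: eq_neg_iff_add_eq_0 add.commute)

lemma base_ring_0: "0 \<in> base_ring"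
  unfolding base_ring_def by (metis base_elem_0 rangeI)

lemma base_ring_add: "x \<in> base_ring \<Longrightarrow> y \<in> base_ring \<Longrightarrow> x + y \<in> base_ring"
  unfolding base_ring_def by (metis (no_types, lifting) base_elem_add imageE rangeI)

lemma base_ring_minus: "x \<in> base_ring \<Longrightarrow> - x \<in> base_ring"
  unfolding base_ring_def by (metis (no_types, lifting) base_elem_minus imageE rangeI)

lemma base_ring_sum: "(\<And>i. i \<in> A \<Longrightarrow> f i \<in> base_ring) \<Longrightarrow> sum f A \<in> base_ring"
  by (induction A rule: infinite_finite_induct) (simp_all add: base_ring_0 base_ring_add)

lemma base_ring_rat_elem_mult:
  assumes "r \<in> \<int>" "x \<in> base_ring"
  shows "rat_elem r * x \<in> base_ring"
proof -
  have n: "rat_elem (of_nat k) * x \<in> base_ring" for k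
    by (induction k) (simp_all add: base_ring_0 base_ring_add rat_elem_add distrib_right assms)
  from assms(1) obtain k where "r = of_int k" by (auto elim: Ints_cases)
  then show ?thesis
    using n base_ring_minus[OF n] by (cases k rule: int_cases2) (auto simp: rat_elem_minus)
qed

text \<open>Both sides are additive in \<open>k\<close> and agree at 1.\<close>

lemma rat_elem_of_int: "(rat_elem (of_int k) :: (int, rat) tensor) = base_elem k"
proof -
  have n: "(rat_elem (of_nat m) :: (int, rat) tensor) = base_elem (int m)" for m
  proof (induction m)
    case (Suc m)
    have "(rat_elem 1 :: (int, rat) tensor) = base_elem 1"
      unfolding rat_elem_def base_elem_def ..
    with Suc show ?case by (simp add: rat_elem_add base_elem_add)
  qed simp
  then show ?thesis
    by (cases k rule: int_cases2) (simp_all add: rat_elem_minus base_elem_minus)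
qed

lemma rat_elem_eq_0_int:
  assumes "(rat_elem r :: (int, rat) tensor) = 0"
  shows "r = 0"
proof -
  obtain a b where r: "r = of_int a / of_int b" "b > 0"
    using Rat_cases[of r] unfolding Fract_of_int_quotient by metis
  \<comment> \<open>Clearing the denominator reduces the claim to injectivity of
    \<open>base_elem\<close> on the integers.\<close>
  have "(base_elem a :: (int, rat) tensor) = rat_elem (of_int b * r)"
    using r by (simp flip: rat_elem_of_int)
  then have "a = 0"
    using assms base_elem_eq_0[OF torsion_free_int, of a] by (simp add: rat_elem_mult)
  then show ?thesis by (simp add: r)
qed

text \<open>For optimality: turns membership in \<open>base_ring\<close> into integrality of a
  rational number.\<close>

lemma rat_elem_in_base_ring_int:
  assumes "(rat_elem r :: (int, rat) tensor) \<in> base_ring"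
  shows "r \<in> \<int>"
proof -
  from assms obtain k where k: "(rat_elem r :: (int, rat) tensor) = rat_elem (of_int k)"
    unfolding base_ring_def by (auto simp: rat_elem_of_int)
  have "(rat_elem (r - of_int k) :: (int, rat) tensor) = 0"
    by (simp only: diff_conv_add_uminus[of r] rat_elem_add rat_elem_minus k add.right_inverse)
  then have "r = of_int k" using rat_elem_eq_0_int by force
  then show ?thesis by simp
qed


section \<open>Odd polynomials\<close>

lemma coeff_pcompose_uminus:
  fixes P :: "'a::{comm_ring, comm_monoid_mult} poly"
  shows "coeff (pcompose P [:0, - 1:]) i = (if even i then coeff P i else - coeff P i)"
  by (induction P arbitrary: i) (auto simp: pcompose_pCons coeff_pCons split: nat.splits)

text \<open>In a general ring 2 may be a zero divisor, so oddness kills only twice the even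
  coefficients.\<close>

lemma odd_poly_iff:
  fixes P :: "'a::{comm_ring, comm_monoid_mult} poly"
  shows "odd_poly P \<longleftrightarrow> (\<forall>i. even i \<longrightarrow> coeff P i + coeff P i = 0)"
  by (auto simp: odd_poly_def poly_eq_iff coeff_pcompose_uminus eq_neg_iff_add_eq_0)

text \<open>Here 2 is invertible, with inverse \<open>rat_elem (1 / 2)\<close>.\<close>

lemma odd_poly_even_coeff:
  fixes P :: "('a::{comm_ring, comm_monoid_mult}, rat) tensor poly"
  assumes "odd_poly P" "even i"
  shows "coeff P i = 0"
proof -
  have "coeff P i = rat_elem (1 / 2 + 1 / 2) * coeff P i" by simp
  also have "\<dots> = rat_elem (1 / 2) * (coeff P i + coeff P i)"
    by (simp only: rat_elem_add distrib_left distrib_right)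
  also have "\<dots> = 0" using assms by (simp add: odd_poly_iff)
  finally show ?thesis .
qed

lemma poly_derivative_at_0: "poly (poly_derivative P) 0 = coeff P 1"
  by (simp add: poly_0_coeff_0 coeff_poly_derivative)

text \<open>Powers are taken inside \<open>rat_elem\<close>, so that the later sum over
  \<open>q\<close> is purely rational.\<close>

lemma poly_rat_elem:
  assumes "degree P \<le> m"
  shows "poly P (rat_elem r) = (\<Sum>i\<le>m. coeff P i * rat_elem (r ^ i))"
  using assms
proof (induction P arbitrary: m)
  case (pCons a P)
  show ?case
  proof (cases m)
    case 0
    with pCons show ?thesis by (auto split: if_splits)
  next
    case (Suc m')
    with pCons have "poly P (rat_elem r) = (\<Sum>i\<le>m'. coeff P i * rat_elem (r ^ i))"
      by (auto split: if_splits)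
    then show ?thesis
      unfolding Suc sum.atMost_Suc_shift
      by (simp add: rat_elem_mult sum_distrib_left mult_ac)
  qed
qed simp

lemma derivative_formula:
  fixes P :: "('a::{comm_ring, comm_monoid_mult}, rat) tensor poly"
  assumes "odd_poly P" "degree P \<le> 2 * n + 1"
  shows "rat_elem (of_nat (e_const n)) * poly (poly_derivative P) 0 =
    (\<Sum>q = 1..n + 1. rat_elem (A_const n q) * poly P (rat_elem (of_nat q)))"
proof -
  have "(\<Sum>q = 1..n + 1. rat_elem (A_const n q) * poly P (rat_elem (of_nat q))) =
    (\<Sum>q = 1..n + 1. \<Sum>i\<le>2 * n + 1. coeff P i * rat_elem (A_const n q * of_nat q ^ i))"
    unfolding poly_rat_elem[OF assms(2)] sum_distrib_left rat_elem_mult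
    by (simp only: mult.left_commute)
  also have "\<dots> = (\<Sum>i\<le>2 * n + 1. coeff P i * rat_elem (\<Sum>q = 1..n + 1. A_const n q * of_nat q ^ i))"
    unfolding rat_elem_sum sum_distrib_left by (rule sum.swap)
  also have "\<dots> = (\<Sum>i\<le>2 * n + 1. if i = 1 then coeff P i * rat_elem (of_nat (e_const n)) else 0)"
  \<comment> \<open>Even \<open>i\<close> drop out because the coefficient vanishes, odd
    \<open>i\<close> other than 1 because the rational sum does.\<close>
  proof (rule sum.cong)
    fix i assume "i \<in> {..2 * n + 1}"
    then show "coeff P i * rat_elem (\<Sum>q = 1..n + 1. A_const n q * of_nat q ^ i) =
        (if i = 1 then coeff P i * rat_elem (of_nat (e_const n)) else 0)"
      using sum_A_const_power[of i n] odd_poly_even_coeff[OF assms(1), of i]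
      by (cases "even i") auto
  qed simp
  also have "\<dots> = rat_elem (of_nat (e_const n)) * poly (poly_derivative P) 0"
    by (simp add: poly_derivative_at_0 mult.commute)
  finally show ?thesis by simp
qed


section \<open>Optimality\<close>

definition gbinomial_poly :: "nat \<Rightarrow> 'a::field_char_0 poly" where
  "gbinomial_poly t = smult (1 / fact t) (\<Prod>i<t. [:- of_nat i, 1:])"

lemma poly_gbinomial_poly: "poly (gbinomial_poly t) x = x gchoose t"
  by (simp add: gbinomial_poly_def poly_prod gbinomial_prod_rev atLeast0LessThan)

lemma degree_gbinomial_poly: "degree (gbinomial_poly t :: 'a::field_char_0 poly) \<le> t"
proof -
  have "degree (\<Prod>i<t. [:- of_nat i, 1:] :: 'a poly) \<le> t"
    using degree_prod_sum_le[of "{..<t}" "\<lambda>i. [:- of_nat i, 1:] :: 'a poly"] by simp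
  then show ?thesis by (simp add: gbinomial_poly_def)
qed

lemma coeff_1_gbinomial_poly:
  assumes "t \<ge> 1"
  shows "coeff (gbinomial_poly t :: 'a::field_char_0 poly) 1 = (- 1) ^ (t - 1) / of_nat t"
proof -
  \<comment> \<open>The factor for \<open>i = 0\<close> makes the constant term vanish, so each
    further factor just multiplies the linear coefficient by \<open>- i\<close>.\<close>
  have "coeff (\<Prod>i<Suc k. [:- of_nat i, 1:] :: 'a poly) 0 = 0 \<and>
      coeff (\<Prod>i<Suc k. [:- of_nat i, 1:] :: 'a poly) 1 = (- 1) ^ k * fact k" for k
  proof (induction k)
    case (Suc k)
    then show ?case
      unfolding prod.lessThan_Suc[of _ "Suc k"]
      by (simp add: coeff_mult algebra_simps del: prod.lessThan_Suc)
  qed simp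
  moreover obtain k where "t = Suc k" using assms by (cases t) auto
  ultimately show ?thesis by (simp add: gbinomial_poly_def del: prod.lessThan_Suc)
qed

lemma poly_map_rat_elem: "poly (map_poly rat_elem P) (rat_elem r) = rat_elem (poly P r)"
  by (induction P) (simp_all add: map_poly_pCons rat_elem_add rat_elem_mult)

lemma admissible_gbinomial:
  assumes "t \<le> 2 * n + 2"
  defines "Q \<equiv> gbinomial_poly t - pcompose (gbinomial_poly t) [:0, - 1:]"
  shows "admissible n (map_poly rat_elem Q :: (int, rat) tensor poly)"
proof -
  let ?P = "map_poly rat_elem Q :: (int, rat) tensor poly"
  have coeff_Q: "coeff Q i = (if even i then 0 else 2 * coeff (gbinomial_poly t) i)" for i
    by (simp add: Q_def coeff_pcompose_uminus)
  have "odd_poly ?P"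
    by (simp add: odd_poly_iff coeff_map_poly coeff_Q)
  moreover have "coeff ?P i = 0" if "i > 2 * n + 1" for i
  proof (cases "even i")
    case False
    \<comment> \<open>An odd \<open>i\<close> above \<open>2 * n + 1\<close> is at least
      \<open>2 * n + 3\<close>, which exceeds \<open>t\<close> even when
      \<open>t = 2 * n + 2\<close>.\<close>
    then have "i > t" using that assms by presburger
    then have "coeff (gbinomial_poly t :: rat poly) i = 0"
      using degree_gbinomial_poly[of t, where 'a = rat] by (intro coeff_eq_0) linarith
    then show ?thesis by (simp add: coeff_map_poly coeff_Q)
  qed (simp add: coeff_map_poly coeff_Q)
  then have "degree ?P \<le> 2 * n + 1" by (intro degree_le) auto
  moreover have "poly ?P (rat_elem (of_int m)) \<in> base_ring" for m
  proof -
    have "(of_int k gchoose t :: rat) \<in> \<int>" for k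
      by (simp flip: of_int_gbinomial)
    from Ints_diff[OF this[of m] this[of "- m"]] have "poly Q (of_int m) \<in> \<int>"
      by (simp add: Q_def poly_pcompose poly_gbinomial_poly)
    moreover have "1 \<in> (base_ring :: (int, rat) tensor set)"
      by (simp add: base_ring_def base_elem_def one_tensor_eq)
    ultimately show ?thesis
      using base_ring_rat_elem_mult[of "poly Q (of_int m)" "1 :: (int, rat) tensor"]
      by (simp add: poly_map_rat_elem)
  qed
  ultimately show ?thesis by (simp add: admissible_def)
qed

lemma e_const_optimal:
  assumes e: "\<And>P :: (int, rat) tensor poly. admissible n P \<Longrightarrow>
    rat_elem (of_nat e) * poly (poly_derivative P) 0 \<in> base_ring"
  shows "e_const n dvd e"
proof -
  \<comment> \<open>Since \<open>2 * e_const n\<close> is the lcm of these \<open>t\<close>, it then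
    divides \<open>2 * e\<close>, and 2 cancels.\<close>
  have "t dvd 2 * e" if t: "t \<in> {1..2 * n + 2}" for t
  proof -
    \<comment> \<open>The linear coefficient of the witness for \<open>t\<close> is twice that of
      \<open>gbinomial_poly t\<close>.\<close>
    have "(rat_elem (of_nat e * (2 * ((- 1) ^ (t - 1) / of_nat t))) :: (int, rat) tensor) \<in> base_ring"
      unfolding rat_elem_mult[of "of_nat e"]
      using e[OF admissible_gbinomial[of t n]] t coeff_1_gbinomial_poly[of t, where 'a = rat]
      by (simp add: poly_derivative_at_0 coeff_map_poly coeff_pcompose_uminus)
    then have "of_nat e * (2 * ((- 1) ^ (t - 1) / of_nat t)) \<in> (\<int> :: rat set)"
      by (rule rat_elem_in_base_ring_int)
    then have "(- 1) ^ (t - 1) * (of_nat e * (2 * ((- 1) ^ (t - 1) / of_nat t))) \<in> (\<int> :: rat set)"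
      by (rule Ints_mult[rotated]) auto
    then have "of_nat (2 * e) / of_nat t \<in> (\<int> :: rat set)"
      by (cases "even (t - 1)") (simp_all add: algebra_simps)
    then obtain k where "of_nat (2 * e) / of_nat t = (of_int k :: rat)"
      by (auto elim: Ints_cases)
    then have "(of_int (int (2 * e)) :: rat) = of_int (int t * k)"
      using t by (simp add: field_simps)
    then have "int t dvd int (2 * e)"
      unfolding of_int_eq_iff by simp
    then show ?thesis by (simp only: int_dvd_int_iff)
  qed
  then have "2 * e_const n dvd 2 * e" unfolding two_e_const by (rule Lcm_least)
  then show ?thesis by simp
qed

theorem lemma4p4p1:
  fixes n :: nat
  assumes "n \<ge> 1"
    and "torsion_free TYPE('a::{comm_ring, comm_monoid_mult})"
  shows "(\<forall>P :: ('a, rat) tensor poly. admissible n P \<longrightarrow>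
            rat_elem (of_nat (e_const n)) * poly (poly_derivative P) 0 \<in> base_ring)
       \<and> (\<forall>e::nat. e > 0 \<longrightarrow>
            (\<forall>P :: (int, rat) tensor poly. admissible n P \<longrightarrow>
               rat_elem (of_nat e) * poly (poly_derivative P) 0 \<in> base_ring) \<longrightarrow>
            e_const n dvd e)
       \<and> (\<forall>P :: ('a, rat) tensor poly. admissible n P \<longrightarrow>
            rat_elem (of_nat (e_const n)) * poly (poly_derivative P) 0 =
              (\<Sum>q = 1..n + 1. rat_elem (A_const n q) * poly P (rat_elem (of_nat q))))
       \<and> (\<forall>q. 1 \<le> q \<and> q \<le> n + 1 \<longrightarrow> A_const n q \<in> \<int>)"
proof (intro conjI allI impI)
  fix P :: "('a, rat) tensor poly"
  assume P: "admissible n P"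
  then show formula: "rat_elem (of_nat (e_const n)) * poly (poly_derivative P) 0 =
      (\<Sum>q = 1..n + 1. rat_elem (A_const n q) * poly P (rat_elem (of_nat q)))"
    by (intro derivative_formula) (auto simp: admissible_def)
  have "poly P (rat_elem (of_nat q)) \<in> base_ring" for q
    using P unfolding admissible_def by (metis of_int_of_nat_eq)
  \<comment> \<open>The formula exhibits the left side as an integer combination of values of
    \<open>P\<close> in \<open>base_ring\<close>.\<close>
  then show "rat_elem (of_nat (e_const n)) * poly (poly_derivative P) 0 \<in> base_ring"
    unfolding formula by (intro base_ring_sum base_ring_rat_elem_mult A_const_Ints) auto
qed (auto intro: A_const_Ints e_const_optimal)

end
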